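(* Let $X$ be a complex Banach space and let $T:X\to X$ be an invertible bounded linear operator. Then $T$ is hyperbolic if and only if $T$ has the shadowing property and, for every $r>0$, the set $H_r(T)$ is a closed subset of $X$.
   Context: Let $X$ be a complex Banach space and $T:X\to X$ an invertible bounded linear operator (with bounded inverse). - $T$ is hyperbolic if $\sigma(T)\cap\mathbb{T}=\varnothing$, where $\sigma(T)$ is the spectrum and $\mathbb{T}=\{z\in\mathbb{C}:|z|=1\}$. - $T$ has the shadowing property if for every $\epsilon>0$ there is $\delta>0$ such that for every sequence $\{x_n\}_{n\in\mathbb{Z}}\subset X$ with $\|T(x_n)-x_{n+1}\|<\delta$ for all $n\in\mathbb{Z}$, there is $x\in X$ with $\|T^n(x)-x_n\|<\epsilon$ for all $n\in\mathbb{Z}$. - For $r>0$, a point $x\in X$ is $r$-homoclinic for $T$ if there is $N\in\mathbb{N}$ such that $\|T^n(x)\|\le r$ for every $n\in\mathbb{Z}$ with $|n|\ge N$; $H_r(T)$ denotes the set of $r$-homoclinic points of $T$. *)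

theory Defs
  imports "HOL-Analysis.Analysis"
begin

text \<open>A complex normed space is a real normed space with a compatible complex scalar multiplication
  whose norm is complex-homogeneous.  The law \<open>1 *\<^sub>C x = x\<close> follows from \<open>scaleR_scaleC\<close>.\<close>

class complex_normed_vector = real_normed_vector +
  fixes scaleC :: "complex \<Rightarrow> 'a \<Rightarrow> 'a"  (infixr "*\<^sub>C" 75)
  assumes scaleC_add_right: "a *\<^sub>C (x + y) = a *\<^sub>C x + a *\<^sub>C y"
    and scaleC_add_left: "(a + b) *\<^sub>C x = a *\<^sub>C x + b *\<^sub>C x"
    and scaleC_scaleC: "a *\<^sub>C (b *\<^sub>C x) = (a * b) *\<^sub>C x"
    and scaleR_scaleC: "r *\<^sub>R x = complex_of_real r *\<^sub>C x"
    and norm_scaleC: "norm (a *\<^sub>C x) = cmod a * norm x"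

class complex_banach = complex_normed_vector + banach

instantiation complex :: complex_banach
begin

definition scaleC_complex :: "complex \<Rightarrow> complex \<Rightarrow> complex" where
  "scaleC_complex a x = a * x"

instance
  by standard
    (simp_all add: scaleC_complex_def algebra_simps norm_mult scaleR_conv_of_real)

end

definition bounded_clinear :: "('a::complex_normed_vector \<Rightarrow> 'b::complex_normed_vector) \<Rightarrow> bool" where
  "bounded_clinear T \<longleftrightarrow> bounded_linear T \<and> (\<forall>c x. T (c *\<^sub>C x) = c *\<^sub>C T x)"

definition invertible_operator :: "('a::complex_normed_vector \<Rightarrow> 'a) \<Rightarrow> bool" where
  "invertible_operator T \<longleftrightarrow>
     bounded_clinear T \<and> (\<exists>S. bounded_clinear S \<and> S \<circ> T = id \<and> T \<circ> S = id)"

definition spectrum :: "('a::complex_normed_vector \<Rightarrow> 'a) \<Rightarrow> complex set" where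
  "spectrum T = {z. \<not> invertible_operator (\<lambda>x. T x - z *\<^sub>C x)}"

definition hyperbolic :: "('a::complex_normed_vector \<Rightarrow> 'a) \<Rightarrow> bool" where
  "hyperbolic T \<longleftrightarrow> spectrum T \<inter> {z. cmod z = 1} = {}"

text \<open>Integer iterates \<open>T\<^sup>n\<close>; meaningful when \<open>T\<close> is bijective.\<close>

definition int_iterate :: "('a \<Rightarrow> 'a) \<Rightarrow> int \<Rightarrow> 'a \<Rightarrow> 'a" where
  "int_iterate T n = (if n \<ge> 0 then T ^^ nat n else inv T ^^ nat (- n))"

definition shadowing_property :: "('a::real_normed_vector \<Rightarrow> 'a) \<Rightarrow> bool" where
  "shadowing_property T \<longleftrightarrow>
     (\<forall>\<epsilon>>0. \<exists>\<delta>>0. \<forall>x :: int \<Rightarrow> 'a.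
        (\<forall>n. norm (T (x n) - x (n + 1)) < \<delta>) \<longrightarrow>
        (\<exists>y. \<forall>n. norm (int_iterate T n y - x n) < \<epsilon>))"

definition homoclinic_points :: "real \<Rightarrow> ('a::real_normed_vector \<Rightarrow> 'a) \<Rightarrow> 'a set" where
  "homoclinic_points r T =
     {x. \<exists>N::nat. \<forall>n::int. \<bar>n\<bar> \<ge> int N \<longrightarrow> norm (int_iterate T n x) \<le> r}"

end

theory Submission
  imports Defs
begin

text \<open>If \<open>T\<close> is hyperbolic, its resolvent is Lipschitz on the unit circle, so \<open>T\<^sup>m (1 - T\<^sup>2\<^sup>m)\<^sup>-\<^sup>1\<close>,
  an alternating average of resolvents at the \<open>2m\<close>-th roots of unity, is small for large \<open>m\<close>.  This
  makes \<open>c \<mapsto> (c (n + 1) - T (c n))\<^sub>n\<close> invertible on bounded two-sided sequences without spectral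
  projections: surjectivity is shadowing, and injectivity makes every \<open>H\<^sub>r\<close> equal to \<open>{0}\<close>.

  Conversely, shadowing together with closedness of all \<open>H\<^sub>r\<close> forces every bounded orbit to tend to
  \<open>0\<close> in both directions, and a sparse sum of translates of a nonzero such orbit would violate
  closedness.  So \<open>0\<close> has the only bounded orbit, and for \<open>|z| = 1\<close> solving
  \<open>c (n + 1) = T (c n) - z\<^sup>n y\<close> boundedly gives, by uniqueness, \<open>c n = z\<^sup>n c 0\<close> and \<open>(T - z) (c 0) = y\<close>.\<close>

section \<open>Complex scalar multiplication\<close>

lemma scaleC_one [simp]: "1 *\<^sub>C (x::'a::complex_normed_vector) = x"
  using scaleR_scaleC[of 1 x] by simp

lemma scaleC_zero_left [simp]: "0 *\<^sub>C (x::'a::complex_normed_vector) = 0"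
  using norm_scaleC[of 0 x] by simp

lemma bounded_linear_scaleC: "bounded_linear (\<lambda>x::'a::complex_normed_vector. c *\<^sub>C x)"
proof (rule bounded_linear_intro[where K = "cmod c"])
  show "c *\<^sub>C (r *\<^sub>R x) = r *\<^sub>R (c *\<^sub>C x)" for r and x :: 'a
    by (simp add: scaleR_scaleC scaleC_scaleC mult.commute)
qed (simp_all add: scaleC_add_right norm_scaleC mult.commute)

lemma scaleC_diff_right: "c *\<^sub>C (x - y) = c *\<^sub>C x - c *\<^sub>C (y::'a::complex_normed_vector)"
  by (rule linear_diff[OF bounded_linear.linear[OF bounded_linear_scaleC]])

lemma scaleC_sum_right: "c *\<^sub>C (\<Sum>i\<in>A. f i) = (\<Sum>i\<in>A. c *\<^sub>C (f i::'a::complex_normed_vector))"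
  by (rule linear_sum[OF bounded_linear.linear[OF bounded_linear_scaleC]])

lemma scaleC_diff_left: "(a - b) *\<^sub>C x = a *\<^sub>C x - b *\<^sub>C (x::'a::complex_normed_vector)"
  using scaleC_add_left[of "a - b" b x] by simp

lemma scaleC_sum_left: "(\<Sum>i\<in>A. f i) *\<^sub>C (x::'a::complex_normed_vector) = (\<Sum>i\<in>A. f i *\<^sub>C x)"
  by (induction A rule: infinite_finite_induct) (auto simp: scaleC_add_left)

lemma bounded_clinear_imp_bounded_linear: "bounded_clinear T \<Longrightarrow> bounded_linear T"
  by (simp add: bounded_clinear_def)

lemma bounded_linear_funpow:
  fixes T :: "'a::real_normed_vector \<Rightarrow> 'a"
  assumes "bounded_linear T"
  shows "bounded_linear (T ^^ n)"
proof (induction n)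
  case 0
  show ?case by (simp add: id_def)
next
  case (Suc n)
  then show ?case using bounded_linear_compose[OF assms] by (simp add: o_def)
qed

lemma bounded_clinear_funpow_scaleC:
  fixes T :: "'a::complex_normed_vector \<Rightarrow> 'a"
  shows "bounded_clinear T \<Longrightarrow> (T ^^ n) (c *\<^sub>C x) = c *\<^sub>C (T ^^ n) x"
  by (induction n) (simp_all add: bounded_clinear_def)

section \<open>Roots of unity\<close>

lemma sum_powers_root_of_unity:
  fixes z :: complex
  assumes "z ^ n = 1"
  shows "(\<Sum>k<n. z ^ k) = (if z = 1 then of_nat n else 0)"
  using assms by (auto simp: geometric_sum)

lemma cis_power_eq_1_iff:
  assumes "m > 0"
  shows "cis (pi / real m) ^ j = 1 \<longleftrightarrow> 2 * m dvd j"
proof -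
  have "cis (pi / real m) ^ j = 1 \<longleftrightarrow> (\<exists>i::int. real j * (pi / real m) = of_int i * (2 * pi))"
    unfolding Complex.DeMoivre by (subst cis_conv_exp, subst exp_eq_1) (simp add: mult_ac)
  also have "\<dots> \<longleftrightarrow> (\<exists>i::int. real j = of_int i * (2 * real m))"
    using assms by (simp add: field_simps)
  also have "\<dots> \<longleftrightarrow> (\<exists>i::int. int j = i * (2 * int m))"
  proof -
    have "real j = of_int i * (2 * real m) \<longleftrightarrow> int j = i * (2 * int m)" for i
      using of_int_eq_iff[where 'a = real, of "int j" "i * (2 * int m)"] by simp
    then show ?thesis by simp
  qed
  also have "\<dots> \<longleftrightarrow> int (2 * m) dvd int j"
    by (simp add: dvd_def mult_ac)
  finally show ?thesis by (simp only: int_dvd_int_iff)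
qed

text \<open>Discrete orthogonality extracts single powers of \<open>T\<close> from sums over the
  \<open>2 * m\<close>-th roots of unity.\<close>

lemma cis_powers_orthogonal:
  assumes "m > 0"
  shows "(\<Sum>k<2*m. cis (pi / real m) ^ (k * j)) = (if 2 * m dvd j then of_nat (2 * m) else 0)"
proof -
  let ?w = "cis (pi / real m)"
  have "(?w ^ j) ^ (2 * m) = 1"
    using cis_power_eq_1_iff[OF assms, of "j * (2 * m)"] by (simp add: power_mult)
  then show ?thesis
    using sum_powers_root_of_unity[of "?w ^ j" "2 * m"] cis_power_eq_1_iff[OF assms, of j]
    by (simp add: power_mult[symmetric] mult.commute)
qed

section \<open>Operators with resolvent bounded on the unit circle\<close>

lemma sum_alternating_pairs:
  fixes v :: "nat \<Rightarrow> 'a::complex_normed_vector"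
  shows "(\<Sum>k<2*m. (-1) ^ k *\<^sub>C v k) = (\<Sum>k<m. v (2*k) - v (Suc (2*k)))"
proof (induction m)
  case (Suc m)
  have "(- 1) *\<^sub>C x = - x" for x :: 'a
    using scaleC_diff_left[of 0 1 x] by simp
  then show ?case using Suc by simp
qed simp

text \<open>A finite geometric sum in \<open>c T\<close>. When \<open>c ^ n = 1\<close>, it links
  the resolvent of \<open>T\<close> at a root of unity with \<open>T ^^ n - 1\<close>.\<close>

lemma telescope_twisted_powers:
  fixes T :: "'a::complex_normed_vector \<Rightarrow> 'a"
  assumes T: "bounded_clinear T"
  shows "(\<Sum>j<n. c ^ j *\<^sub>C (T ^^ j) (c *\<^sub>C T v - v)) = c ^ n *\<^sub>C (T ^^ n) v - v"
proof -
  have "(T ^^ j) (c *\<^sub>C T v - v) = c *\<^sub>C (T ^^ Suc j) v - (T ^^ j) v" for j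
    using linear_diff[OF bounded_linear.linear[OF bounded_linear_funpow[of T j]]] T
    by (simp add: bounded_clinear_funpow_scaleC bounded_clinear_imp_bounded_linear funpow_swap1)
  then have "(\<Sum>j<n. c ^ j *\<^sub>C (T ^^ j) (c *\<^sub>C T v - v))
      = (\<Sum>j<n. c ^ Suc j *\<^sub>C (T ^^ Suc j) v - c ^ j *\<^sub>C (T ^^ j) v)"
    by (simp add: scaleC_diff_right scaleC_scaleC mult.commute)
  also have "\<dots> = c ^ n *\<^sub>C (T ^^ n) v - v"
    by (subst sum_lessThan_telescope) simp
  finally show ?thesis .
qed

text \<open>Each lower bound for \<open>T - z\<close> survives nearby with a doubled constant, and
  compactness leaves finitely many constants. The form \<open>c T - 1\<close> fits the geometric
  sums used later.\<close>

lemma resolvent_bounded_on_circle: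
  fixes T :: "'a::complex_normed_vector \<Rightarrow> 'a"
  assumes "hyperbolic T"
  shows "\<exists>K>0. \<forall>c x. cmod c = 1 \<longrightarrow> norm x \<le> K * norm (c *\<^sub>C T x - x)"
proof -
  have ex: "\<exists>K>0. \<forall>x. norm x \<le> K * norm (T x - z *\<^sub>C x)" if z: "cmod z = 1" for z
  proof -
    have "invertible_operator (\<lambda>x. T x - z *\<^sub>C x)"
      using assms z by (auto simp: hyperbolic_def spectrum_def)
    then obtain R where R: "bounded_clinear R" "\<And>x. R (T x - z *\<^sub>C x) = x"
      unfolding invertible_operator_def by (auto simp: fun_eq_iff)
    obtain K where "K > 0" "\<And>x. norm (R x) \<le> norm x * K"
      using bounded_linear.pos_bounded[OF bounded_clinear_imp_bounded_linear[OF R(1)]] by blast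
    then have "norm x \<le> K * norm (T x - z *\<^sub>C x)" for x
      using R(2)[of x] by (metis mult.commute)
    then show ?thesis using \<open>K > 0\<close> by blast
  qed
  then obtain k where k: "\<And>z. cmod z = 1 \<Longrightarrow> k z > 0"
    "\<And>z x. cmod z = 1 \<Longrightarrow> norm x \<le> k z * norm (T x - z *\<^sub>C x)"
    by metis
  \<comment> \<open>The radius lets the perturbation \<open>w - z\<close> account for at most half
    of \<open>norm x\<close>, hence the factor 2.\<close>
  have loc: "norm x \<le> 2 * k z * norm (T x - w *\<^sub>C x)"
    if z: "cmod z = 1" and w: "w \<in> ball z (1 / (2 * k z))" for z w x
  proof -
    have "T x - z *\<^sub>C x = (T x - w *\<^sub>C x) + (w - z) *\<^sub>C x"
      by (simp add: scaleC_diff_left)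
    then have "norm (T x - z *\<^sub>C x) \<le> norm (T x - w *\<^sub>C x) + cmod (w - z) * norm x"
      by (metis norm_triangle_ineq norm_scaleC)
    then have "norm x \<le> k z * (norm (T x - w *\<^sub>C x) + cmod (w - z) * norm x)"
      using order_trans[OF k(2)[OF z, of x] mult_left_mono[OF _ less_imp_le[OF k(1)[OF z]]]] by simp
    moreover have "k z * (cmod (w - z) * norm x) \<le> 1/2 * norm x"
    proof -
      have "k z * cmod (w - z) \<le> 1/2"
        using w k(1)[OF z] by (simp add: dist_norm norm_minus_commute field_simps)
      then have "(k z * cmod (w - z)) * norm x \<le> 1/2 * norm x" by (intro mult_right_mono) simp_all
      then show ?thesis by (simp only: mult.assoc)
    qed
    ultimately show ?thesis by (simp add: distrib_left)
  qed
  have "compact (sphere (0::complex) 1)" by simp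
  then obtain C where C: "C \<subseteq> sphere 0 1" "finite C"
      "sphere (0::complex) 1 \<subseteq> (\<Union>z\<in>C. ball z (1 / (2 * k z)))"
  proof (rule compactE_image[where f = "\<lambda>z. ball z (1 / (2 * k z))" and C = "sphere 0 1"])
    show "sphere 0 1 \<subseteq> (\<Union>z\<in>sphere 0 1. ball z (1 / (2 * k z)))"
      using k(1) by force
  qed auto
  define K where "K = (\<Sum>z\<in>C. 2 * k z)"
  have K: "2 * k z \<le> K" if "z \<in> C" for z
    unfolding K_def
  proof (rule member_le_sum[OF that _ C(2)])
    show "0 \<le> 2 * k x" if "x \<in> C - {z}" for x
      using k(1)[of x] C(1) that by fastforce
  qed
  have main: "norm x \<le> K * norm (T x - w *\<^sub>C x)" if w: "cmod w = 1" for w x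
  proof -
    obtain z where z: "z \<in> C" "w \<in> ball z (1 / (2 * k z))"
      using subsetD[OF C(3), of w] w by auto
    then have "norm x \<le> 2 * k z * norm (T x - w *\<^sub>C x)"
      using loc C(1) by auto
    also have "\<dots> \<le> K * norm (T x - w *\<^sub>C x)"
      using K[OF z(1)] by (intro mult_right_mono) auto
    finally show ?thesis .
  qed
  have "norm x \<le> K * norm (c *\<^sub>C T x - x)" if c: "cmod c = 1" for c x
  proof -
    have "c \<noteq> 0" using c by auto
    then have "c *\<^sub>C T x - x = c *\<^sub>C (T x - inverse c *\<^sub>C x)"
      by (simp add: scaleC_diff_right scaleC_scaleC)
    then have "norm (c *\<^sub>C T x - x) = norm (T x - inverse c *\<^sub>C x)"
      using c by (simp add: norm_scaleC)
    then show ?thesis using main[of "inverse c" x] c by (simp add: norm_inverse)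
  qed
  moreover have "K > 0"
  proof -
    obtain z where "z \<in> C" using subsetD[OF C(3), of 1] by auto
    then show ?thesis using K[of z] k(1)[of z] C(1) by auto
  qed
  ultimately show ?thesis by blast
qed

lemma hyperbolic_resolvent:
  fixes T :: "'a::complex_normed_vector \<Rightarrow> 'a"
  assumes "hyperbolic T" "cmod c = 1"
  shows "\<exists>R. bounded_linear R \<and> (\<forall>y. c *\<^sub>C T (R y) - R y = y)"
proof -
  have c: "c \<noteq> 0" using assms by auto
  have "invertible_operator (\<lambda>x. T x - inverse c *\<^sub>C x)"
    using assms by (auto simp: hyperbolic_def spectrum_def norm_inverse)
  then obtain R where R: "bounded_clinear R" "\<And>y. T (R y) - inverse c *\<^sub>C R y = y"
    unfolding invertible_operator_def by (auto simp: fun_eq_iff)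
  have lin: "bounded_linear (\<lambda>y. R (inverse c *\<^sub>C y))"
    using R(1) bounded_clinear_imp_bounded_linear bounded_linear_compose bounded_linear_scaleC by blast
  have eq: "c *\<^sub>C T (R (inverse c *\<^sub>C y)) - R (inverse c *\<^sub>C y) = y" for y
  proof -
    let ?u = "R (inverse c *\<^sub>C y)"
    have "c *\<^sub>C T ?u - ?u = c *\<^sub>C (T ?u - inverse c *\<^sub>C ?u)"
      using c by (simp add: scaleC_diff_right scaleC_scaleC)
    also have "\<dots> = y" unfolding R(2) using c by (simp add: scaleC_scaleC)
    finally show ?thesis .
  qed
  show ?thesis using lin eq by blast
qed

text \<open>The function \<open>t\<^sup>m / (1 - t\<^sup>2\<^sup>m)\<close> has the partial fraction expansion
  \<open>1/2m \<cdot> \<Sum>\<^sub>k (-1)\<^sup>k / (1 - w\<^sup>k t)\<close> with \<open>w = exp (i\<pi>/m)\<close>.  Consecutive summands almost cancel because the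
  resolvent is Lipschitz on the circle.\<close>

lemma hyperbolic_middle_power_small:
  fixes T :: "'a::complex_normed_vector \<Rightarrow> 'a"
  assumes T: "bounded_clinear T" and hyp: "hyperbolic T"
  shows "\<exists>m>0. \<forall>x. norm ((T ^^ m) x) \<le> 1/4 * norm (x - (T ^^ (2*m)) x)"
proof -
  obtain K where K: "K > 0" "\<And>c x. cmod c = 1 \<Longrightarrow> norm x \<le> K * norm (c *\<^sub>C T x - x)"
    using resolvent_bounded_on_circle[OF hyp] by auto
  obtain M where M: "M > 0" "\<And>x. norm (T x) \<le> norm x * M"
    using bounded_linear.pos_bounded[OF bounded_clinear_imp_bounded_linear[OF T]] by blast
  have "((\<lambda>m. cis (pi / real m)) \<longlonglongrightarrow> cis 0)"
    by (rule tendsto_cis) (auto intro!: lim_const_over_n)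
  \<comment> \<open>Threshold for \<open>w - 1\<close>: one \<open>K\<close> bounds the
    \<open>v k\<close> below, the other their differences, and \<open>M\<close> bounds
    \<open>T\<close>; a factor 1/2 remains in \<open>vd\<close>.\<close>
  moreover have "0 < 1 / (2 * K\<^sup>2 * M)" using K(1) M(1) by simp
  ultimately obtain m0 where m0: "\<And>m. m \<ge> m0 \<Longrightarrow> norm (cis (pi / real m) - 1) < 1 / (2 * K\<^sup>2 * M)"
    using LIMSEQ_D[of _ "cis 0"] unfolding cis_zero by blast
  define m where "m = Suc m0"
  have m: "m > 0" by (simp add: m_def)
  define w where "w = cis (pi / real m)"
  have w1: "cmod w = 1" by (simp add: w_def)
  have wsmall: "cmod (w - 1) \<le> 1 / (2 * K\<^sup>2 * M)"
    using m0[of m] unfolding w_def m_def by simp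
  have wm: "w ^ m = -1" unfolding w_def Complex.DeMoivre using m by simp
  have w2m: "(w ^ k) ^ (2 * m) = 1" for k
    using cis_power_eq_1_iff[OF m, of "k * (2 * m)"] by (simp add: w_def power_mult)
  have "norm ((T ^^ m) x) \<le> 1/4 * norm (x - (T ^^ (2*m)) x)" for x
  proof -
    define y where "y = (T ^^ (2*m)) x - x"
    \<comment> \<open>A finite geometric sum that represents the inverse of
      \<open>w ^ k T - 1\<close> applied to \<open>y\<close>.\<close>
    define v where "v k = (\<Sum>j<2*m. (w ^ k) ^ j *\<^sub>C (T ^^ j) x)" for k
    interpret T: bounded_linear T using T by (rule bounded_clinear_imp_bounded_linear)
    have Dv: "w ^ k *\<^sub>C T (v k) - v k = y" for k
    proof -
      have "w ^ k *\<^sub>C T (v k) - v k = (\<Sum>j<2*m. (w ^ k) ^ j *\<^sub>C (w ^ k *\<^sub>C T ((T ^^ j) x) - (T ^^ j) x))"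
        using T by (simp add: v_def T.sum bounded_clinear_def scaleC_sum_right sum_subtractf
            scaleC_diff_right scaleC_scaleC mult.commute)
      also have "\<dots> = (\<Sum>j<2*m. (w ^ k) ^ Suc j *\<^sub>C (T ^^ Suc j) x - (w ^ k) ^ j *\<^sub>C (T ^^ j) x)"
        by (simp add: scaleC_diff_right scaleC_scaleC mult.commute)
      also have "\<dots> = y"
        by (subst sum_lessThan_telescope) (simp add: y_def w2m)
      finally show ?thesis .
    qed
    have vb: "norm (v k) \<le> K * norm y" for k
      using K(2)[of "w ^ k" "v k"] by (simp add: Dv w1 norm_power)
    have vd: "norm (v k - v (Suc k)) \<le> 1/2 * norm y" for k
    proof -
      \<comment> \<open>A form of the resolvent identity: the two copies of \<open>y\<close> cancel,
        leaving only the change of coefficient.\<close>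
      have "w ^ k *\<^sub>C T (v k - v (Suc k)) - (v k - v (Suc k))
          = (w ^ k *\<^sub>C T (v k) - v k) - (w ^ Suc k *\<^sub>C T (v (Suc k)) - v (Suc k))
            + (w ^ Suc k - w ^ k) *\<^sub>C T (v (Suc k))"
        by (simp add: T.diff scaleC_diff_right scaleC_diff_left)
      then have "w ^ k *\<^sub>C T (v k - v (Suc k)) - (v k - v (Suc k))
          = (w ^ Suc k - w ^ k) *\<^sub>C T (v (Suc k))"
        by (simp only: Dv diff_self add_0_left)
      then have "norm (v k - v (Suc k)) \<le> K * (cmod (w ^ Suc k - w ^ k) * norm (T (v (Suc k))))"
        using K(2)[of "w ^ k" "v k - v (Suc k)"] by (simp add: w1 norm_power norm_scaleC)
      also have "cmod (w ^ Suc k - w ^ k) = cmod (w - 1)"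
      proof -
        have "w ^ Suc k - w ^ k = (w - 1) * w ^ k" by (simp add: algebra_simps)
        then show ?thesis by (simp add: norm_mult norm_power w1)
      qed
      also have "K * (cmod (w - 1) * norm (T (v (Suc k)))) \<le> K * (1 / (2 * K\<^sup>2 * M) * ((K * norm y) * M))"
      proof (intro mult_left_mono mult_mono wsmall)
        show "norm (T (v (Suc k))) \<le> (K * norm y) * M"
          using M by (intro order_trans[OF M(2)] mult_right_mono vb less_imp_le)
      qed (use K(1) M(1) in simp_all)
      also have "\<dots> = 1/2 * norm y"
        using K(1) M(1) by (simp add: field_simps power2_eq_square)
      finally show ?thesis .
    qed
    \<comment> \<open>Since \<open>w ^ m = -1\<close>, the sign \<open>(-1) ^ k\<close> is
      \<open>w ^ (k * m)\<close>; this shift makes orthogonality select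
      \<open>j = m\<close>.\<close>
    have "(\<Sum>k<2*m. (-1) ^ k *\<^sub>C v k) = (\<Sum>j<2*m. (\<Sum>k<2*m. w ^ (k * (m + j))) *\<^sub>C (T ^^ j) x)"
    proof -
      have "(-1) ^ k *\<^sub>C v k = (\<Sum>j<2*m. w ^ (k * (m + j)) *\<^sub>C (T ^^ j) x)" for k
        by (simp add: v_def scaleC_sum_right scaleC_scaleC flip: wm)
           (simp add: algebra_simps flip: power_mult power_add)
      then show ?thesis
        by (simp add: scaleC_sum_left) (rule sum.swap)
    qed
    also have "\<dots> = (\<Sum>j<2*m. if j = m then of_nat (2*m) *\<^sub>C (T ^^ m) x else 0)"
    proof (rule sum.cong[OF refl])
      fix j assume j: "j \<in> {..<2*m}"
      have "2 * m dvd m + j \<longleftrightarrow> j = m"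
      proof
        assume "2 * m dvd m + j"
        then obtain q where q: "m + j = 2 * m * q" by blast
        then have "2 * m * q < 2 * m * 2" using j unfolding lessThan_iff by linarith
        then have "q < 2" by (metis mult_less_cancel1)
        moreover have "q \<noteq> 0" using q m by (intro notI) simp
        ultimately have "q = 1" by simp
        then show "j = m" using q by simp
      qed (simp add: mult_2)
      then show "(\<Sum>k<2*m. w ^ (k * (m + j))) *\<^sub>C (T ^^ j) x = (if j = m then of_nat (2*m) *\<^sub>C (T ^^ m) x else 0)"
        unfolding w_def cis_powers_orthogonal[OF m] by auto
    qed
    also have "\<dots> = of_nat (2*m) *\<^sub>C (T ^^ m) x"
      using m by simp
    \<comment> \<open>Each of the \<open>m\<close> pairs contributes at most
      \<open>norm y / 2\<close>; dividing by \<open>2 * m\<close> gives 1/4.\<close>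
    finally have "real (2*m) * norm ((T ^^ m) x) = norm (\<Sum>k<m. v (2*k) - v (Suc (2*k)))"
      unfolding sum_alternating_pairs by (metis norm_scaleC norm_of_nat)
    also have "\<dots> \<le> (\<Sum>k<m. 1/2 * norm y)"
      by (rule sum_norm_le) (rule vd)
    finally have "norm ((T ^^ m) x) \<le> 1/4 * norm y"
      using m by (simp add: field_simps)
    then show ?thesis by (simp add: y_def norm_minus_commute)
  qed
  then show ?thesis using m by blast
qed

text \<open>Partial fractions without signs: \<open>1 / (1 - t ^ (2*m))\<close> is the average of
  \<open>1 / (1 - w ^ k * t)\<close> over the \<open>2 * m\<close>-th roots of unity.\<close>

lemma hyperbolic_power_right_inverse:
  fixes T :: "'a::complex_normed_vector \<Rightarrow> 'a"
  assumes T: "bounded_clinear T" and hyp: "hyperbolic T" and m: "m > 0"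
  shows "\<exists>Q. bounded_linear Q \<and> (\<forall>y. Q y - (T ^^ (2*m)) (Q y) = y)"
proof -
  obtain R where R: "\<And>c. cmod c = 1 \<Longrightarrow> bounded_linear (R c)"
    "\<And>c y. cmod c = 1 \<Longrightarrow> c *\<^sub>C T (R c y) - R c y = y"
    using hyperbolic_resolvent[OF hyp] by metis
  define w where "w = cis (pi / real m)"
  have w1: "cmod (w ^ k) = 1" for k by (simp add: w_def norm_power)
  have w2m: "(w ^ k) ^ (2 * m) = 1" for k
    using cis_power_eq_1_iff[OF m, of "k * (2 * m)"] by (simp add: w_def power_mult)
  \<comment> \<open>The minus sign appears because \<open>R c\<close> is a right inverse of
    \<open>c T - 1\<close>, not of \<open>1 - c T\<close>.\<close>
  define Q where "Q y = (- 1 / real (2*m)) *\<^sub>R (\<Sum>k<2*m. R (w ^ k) y)" for y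
  interpret P: bounded_linear "T ^^ (2*m)"
    using T by (intro bounded_linear_funpow bounded_clinear_imp_bounded_linear)
  have lin: "bounded_linear Q"
    unfolding Q_def
    by (intro bounded_linear_compose[OF bounded_linear_scaleR_right] bounded_linear_sum R w1)
  have eq: "Q y - (T ^^ (2*m)) (Q y) = y" for y
  proof -
    have RT: "(T ^^ (2*m)) (R (w ^ k) y) - R (w ^ k) y = (\<Sum>j<2*m. w ^ (k * j) *\<^sub>C (T ^^ j) y)" for k
      using telescope_twisted_powers[OF T, where c = "w ^ k" and v = "R (w ^ k) y" and n = "2 * m"]
      unfolding R(2)[OF w1] w2m scaleC_one by (simp add: power_mult)
    have "(\<Sum>k<2*m. (T ^^ (2*m)) (R (w ^ k) y) - R (w ^ k) y)
        = (\<Sum>j<2*m. (\<Sum>k<2*m. w ^ (k * j)) *\<^sub>C (T ^^ j) y)"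
      unfolding RT scaleC_sum_left by (rule sum.swap)
    also have "\<dots> = (\<Sum>j<2*m. if j = 0 then of_nat (2*m) *\<^sub>C y else 0)"
      unfolding w_def cis_powers_orthogonal[OF m]
      by (intro sum.cong refl) (auto dest: dvd_imp_le)
    also have "\<dots> = of_nat (2*m) *\<^sub>C y" using m by simp
    also have "\<dots> = real (2*m) *\<^sub>R y" by (simp add: scaleR_scaleC)
    finally have s: "(\<Sum>k<2*m. (T ^^ (2*m)) (R (w ^ k) y) - R (w ^ k) y) = real (2*m) *\<^sub>R y" .
    have "Q y - (T ^^ (2*m)) (Q y)
        = (1 / real (2*m)) *\<^sub>R (\<Sum>k<2*m. (T ^^ (2*m)) (R (w ^ k) y) - R (w ^ k) y)"
      by (simp add: Q_def P.scaleR P.sum P.neg sum_subtractf scaleR_diff_right)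
    also have "\<dots> = y" unfolding s using m by simp
    finally show ?thesis .
  qed
  show ?thesis using lin eq by blast
qed

section \<open>Two-sided orbits\<close>

locale invertible_pair =
  fixes T S :: "'a::complex_banach \<Rightarrow> 'a"
  assumes T: "bounded_clinear T" and S: "bounded_clinear S"
    and ST [simp]: "S (T x) = x" and TS [simp]: "T (S x) = x"
begin

abbreviation orb :: "int \<Rightarrow> 'a \<Rightarrow> 'a" where
  "orb \<equiv> int_iterate T"

sublocale T: bounded_linear T
  using T by (rule bounded_clinear_imp_bounded_linear)

sublocale S: bounded_linear S
  using S by (rule bounded_clinear_imp_bounded_linear)

lemma inv_eq: "inv T = S"
  by (rule inv_equality) simp_all

lemma orb_nonneg: "n \<ge> 0 \<Longrightarrow> orb n x = (T ^^ nat n) x"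
  by (simp add: int_iterate_def)

lemma orb_nonpos: "n \<le> 0 \<Longrightarrow> orb n x = (S ^^ nat (- n)) x"
  by (auto simp: int_iterate_def inv_eq)

lemma orb_0 [simp]: "orb 0 x = x"
  by (simp add: orb_nonneg)

lemma orb_Suc: "orb (n + 1) x = T (orb n x)"
proof (cases "n \<ge> 0")
  case True
  then show ?thesis by (simp add: orb_nonneg nat_add_distrib)
next
  case False
  then have "nat (- n) = Suc (nat (- (n + 1)))" by simp
  then show ?thesis using False orb_nonpos[of n x] orb_nonpos[of "n + 1" x] by simp
qed

text \<open>Backward steps rest on injectivity of \<open>T\<close>. Later arguments verify only the
  recurrence and obtain a genuine orbit.\<close>

lemma orb_unique:
  assumes "\<And>n. u (n + 1) = T (u n)"
  shows "u n = orb n (u 0)"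
proof (induction n rule: int_induct[where k = 0])
  case base
  show ?case by simp
next
  case (step1 i)
  then show ?case by (simp add: assms orb_Suc)
next
  case (step2 i)
  then have "T (u (i - 1)) = T (orb (i - 1) (u 0))"
    using assms[of "i - 1"] orb_Suc[of "i - 1" "u 0"] by simp
  then show ?case by (metis ST)
qed

lemma orb_add: "orb (m + n) x = orb m (orb n x)"
  using orb_unique[of "\<lambda>k. orb (k + n) x" m] orb_Suc[of "_ + n" x] by (simp add: algebra_simps)

lemma bounded_linear_orb: "bounded_linear (orb n)"
proof (cases "n \<ge> 0")
  case True
  then have "orb n = T ^^ nat n" by (intro ext) (rule orb_nonneg)
  then show ?thesis using bounded_linear_funpow[OF T.bounded_linear_axioms] by simp
next
  case False
  then have "orb n = S ^^ nat (- n)" by (intro ext) (simp add: orb_nonpos)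
  then show ?thesis using bounded_linear_funpow[OF S.bounded_linear_axioms] by simp
qed

sublocale orb: bounded_linear "orb n" for n
  by (rule bounded_linear_orb)

text \<open>Recursion from value 0 at time 0, forwards by \<open>T\<close> and backwards by
  \<open>S\<close>. No bound is claimed; shadowing supplies it later.\<close>

lemma ex_inhomogeneous_orbit: "\<exists>x. \<forall>n. x (n + 1) = T (x n) + f (n::int)"
proof -
  define p where "p = rec_nat (0::'a) (\<lambda>k v. T v + f (int k))"
  define q where "q = rec_nat (0::'a) (\<lambda>k v. S (v - f (- int k - 1)))"
  define x where "x n = (if n \<ge> 0 then p (nat n) else q (nat (- n)))" for n
  have x_nonpos: "x n = q (nat (- n))" if "n \<le> 0" for n
    using that by (auto simp: x_def p_def q_def)
  have "x (n + 1) = T (x n) + f n" for n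
  proof (cases "n \<ge> 0")
    case True
    then show ?thesis by (simp add: x_def p_def nat_add_distrib)
  next
    case False
    then have "nat (- n) = Suc (nat (- (n + 1)))" by simp
    then show ?thesis using False x_nonpos[of n] x_nonpos[of "n + 1"] by (simp add: q_def)
  qed
  then show ?thesis by blast
qed

section \<open>Hyperbolicity implies shadowing\<close>

text \<open>The middle power estimate, applied along the orbit, halves any uniform bound.\<close>

lemma hyperbolic_bounded_orbit_zero:
  assumes hyp: "hyperbolic T" and B: "\<And>n. norm (orb n x) \<le> B"
  shows "x = 0"
proof -
  obtain m where m: "\<And>x. norm ((T ^^ m) x) \<le> 1/4 * norm (x - (T ^^ (2*m)) x)"
    using hyperbolic_middle_power_small[OF T hyp] by blast
  have bound: "norm (orb n x) \<le> B * (1/2) ^ k" for n k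
  proof (induction k arbitrary: n)
    case 0
    then show ?case using B by simp
  next
    case (Suc k)
    \<comment> \<open>Starting \<open>m\<close> steps earlier puts \<open>orb n x\<close> midway
      between times \<open>n - m\<close> and \<open>n + m\<close>.\<close>
    let ?z = "orb (n - int m) x"
    have pow: "(T ^^ i) ?z = orb (n - int m + int i) x" for i
      using orb_add[of "int i" "n - int m" x] by (simp add: orb_nonneg add.commute)
    have "norm (orb n x) = norm ((T ^^ m) ?z)" by (simp add: pow)
    also have "\<dots> \<le> 1/4 * norm (?z - (T ^^ (2*m)) ?z)" by (rule m)
    also have "\<dots> \<le> 1/4 * (norm ?z + norm ((T ^^ (2*m)) ?z))"
      by (intro mult_left_mono norm_triangle_ineq4) simp
    also have "\<dots> \<le> 1/4 * (B * (1/2) ^ k + B * (1/2) ^ k)"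
      unfolding pow by (intro mult_left_mono add_mono Suc.IH) simp
    finally show ?case by simp
  qed
  have lim: "(\<lambda>k. B * (1/2) ^ k) \<longlonglongrightarrow> B * 0"
    by (intro tendsto_intros LIMSEQ_realpow_zero) simp_all
  have "norm (orb 0 x) \<le> B * 0"
    by (rule LIMSEQ_le_const[OF lim]) (intro exI allI impI bound)
  then show ?thesis by simp
qed

text \<open>Only finitely many times escape the bound \<open>r\<close>, so a homoclinic orbit is
  bounded and hence zero.\<close>

lemma hyperbolic_homoclinic_points:
  assumes "hyperbolic T" "r > 0"
  shows "homoclinic_points r T = {0}"
proof -
  have "x = 0" if x: "x \<in> homoclinic_points r T" for x
  proof -
    obtain N where N: "\<And>n. \<bar>n\<bar> \<ge> int N \<Longrightarrow> norm (orb n x) \<le> r"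
      using x by (auto simp: homoclinic_points_def)
    define B where "B = max r (Max ((\<lambda>n. norm (orb n x)) ` {- int N..int N}))"
    have "norm (orb n x) \<le> B" for n
    proof (cases "\<bar>n\<bar> \<ge> int N")
      case True
      then show ?thesis using N[of n] by (simp add: B_def)
    next
      case False
      then have "norm (orb n x) \<le> Max ((\<lambda>n. norm (orb n x)) ` {- int N..int N})"
        by (intro Max_ge imageI) auto
      then show ?thesis by (simp add: B_def)
    qed
    then show ?thesis by (rule hyperbolic_bounded_orbit_zero[OF assms(1)])
  qed
  moreover have "0 \<in> homoclinic_points r T"
    using assms(2) by (auto simp: homoclinic_points_def orb.zero)
  ultimately show ?thesis by blast
qed

text \<open>Neumann series on bounded two-sided sequences: the perturbation has norm at most 1/2,
  and \<open>e k\<close> below is the \<open>k\<close>-th term.\<close>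

lemma ex_small_perturbation_solution:
  fixes f :: "int \<Rightarrow> 'a"
  assumes B: "bounded_linear B" "\<And>y. norm (B y) \<le> 1/4 * norm y"
    and f: "\<And>n. norm (f n) \<le> d"
  shows "\<exists>g. \<forall>n. g n + B (g (n + m) - g (n - m)) = f n \<and> norm (g n) \<le> 2 * d"
proof -
  interpret B: bounded_linear B by fact
  define e where "e = rec_nat f (\<lambda>_ u n. - B (u (n + m) - u (n - m)))"
  have e_0: "e 0 n = f n" and e_Suc: "e (Suc k) n = - B (e k (n + m) - e k (n - m))" for k n
    by (simp_all add: e_def)
  have en: "norm (e k n) \<le> d * (1/2) ^ k" for k n
  proof (induction k arbitrary: n)
    case 0
    show ?case using f by (simp add: e_0)
  next
    case (Suc k)
    have "norm (e (Suc k) n) \<le> 1/4 * norm (e k (n + m) - e k (n - m))"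
      using B(2) by (simp add: e_Suc)
    also have "\<dots> \<le> 1/4 * (norm (e k (n + m)) + norm (e k (n - m)))"
      by (intro mult_left_mono norm_triangle_ineq4) simp
    also have "\<dots> \<le> 1/4 * (d * (1/2) ^ k + d * (1/2) ^ k)"
      by (intro mult_left_mono add_mono Suc.IH) simp
    finally show ?case by simp
  qed
  have geo: "(\<lambda>k. d * (1/2) ^ k) sums (d * 2)"
    using geometric_sums[of "1/2::real"] by (intro sums_mult) simp
  have summ: "summable (\<lambda>k. e k n)" for n
    by (rule summable_comparison_test'[OF sums_summable[OF geo]]) (rule en)
  define g where "g n = (\<Sum>k. e k n)" for n
  have "g n + B (g (n + m) - g (n - m)) = f n" for n
  proof -
    have "B (g (n + m) - g (n - m)) = B (\<Sum>k. e k (n + m) - e k (n - m))"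
      by (simp add: g_def suminf_diff summ)
    also have "\<dots> = (\<Sum>k. B (e k (n + m) - e k (n - m)))"
      by (intro B.suminf summable_diff summ)
    also have "\<dots> = (\<Sum>k. - e (Suc k) n)"
      by (simp add: e_Suc)
    also have "\<dots> = - (\<Sum>k. e (Suc k) n)"
      using summable_Suc_iff[where f = "\<lambda>k. e k n"] by (intro suminf_minus) (simp add: summ)
    also have "\<dots> = f n - g n"
      using suminf_split_head[OF summ[of n]] by (simp add: g_def e_0)
    finally show ?thesis by simp
  qed
  moreover have "norm (g n) \<le> 2 * d" for n
    using norm_suminf_le[OF en[of _ n] sums_summable[OF geo]] sums_unique[OF geo]
    by (simp add: g_def mult.commute)
  ultimately show ?thesis by (intro exI[of _ g] allI conjI)
qed

text \<open>With \<open>Q = (1 - T\<^sup>2\<^sup>m)\<^sup>-\<^sup>1\<close>, the truncation \<open>T\<^sup>j Q\<close> for \<open>-m \<le> j < m\<close>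
  (\<open>T\<^sup>j Q\<close> replaced by \<open>T\<^sup>j\<^sup>+\<^sup>2\<^sup>m Q\<close> for negative \<open>j\<close>) of Green's function of
  \<open>c (n + 1) - T (c n) = f n\<close> is a right inverse up to an error \<open>T\<^sup>m Q\<close> at both ends, which
  is small and is absorbed by a Neumann series.\<close>

lemma hyperbolic_inhomogeneous_solution:
  assumes hyp: "hyperbolic T"
  shows "\<exists>C>0. \<forall>d f. (\<forall>n. norm (f n) \<le> d) \<longrightarrow>
    (\<exists>c. \<forall>n::int. c (n + 1) - T (c n) = f n \<and> norm (c n) \<le> C * d)"
proof -
  obtain m where m0: "m > 0" and m: "\<And>x. norm ((T ^^ m) x) \<le> 1/4 * norm (x - (T ^^ (2*m)) x)"
    using hyperbolic_middle_power_small[OF T hyp] by blast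
  obtain Q where Q: "bounded_linear Q" "\<And>y. Q y - (T ^^ (2*m)) (Q y) = y"
    using hyperbolic_power_right_inverse[OF T hyp m0] by blast
  define B where "B y = (T ^^ m) (Q y)" for y
  have P: "bounded_linear (T ^^ j)" for j
    by (rule bounded_linear_funpow) (rule T.bounded_linear_axioms)
  have B: "bounded_linear B"
    unfolding B_def by (rule bounded_linear_compose[OF P Q(1)])
  have B_small: "norm (B y) \<le> 1/4 * norm y" for y
    using m[of "Q y"] unfolding B_def Q(2) .
  interpret B: bounded_linear B by (rule B)
  interpret Q: bounded_linear Q by (rule Q)
  obtain q where q: "q > 0" "\<And>y. norm (Q y) \<le> norm y * q"
    using Q.pos_bounded by blast
  have "\<forall>j. \<exists>K>0. \<forall>y. norm ((T ^^ j) y) \<le> norm y * K"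
    by (intro allI bounded_linear.pos_bounded P)
  then obtain p where p: "\<And>j. p j > 0" "\<And>j y. norm ((T ^^ j) y) \<le> norm y * p j"
    by metis
  define C where "C = (\<Sum>j<m. (2 * q + 1/2) * p j)"
  have C: "C > 0"
    unfolding C_def using m0 q(1) by (intro sum_pos mult_pos_pos p(1)) auto
  have main: "\<exists>c. \<forall>n. c (n + 1) - T (c n) = f n \<and> norm (c n) \<le> C * d"
    if f: "\<forall>n. norm (f n) \<le> d" for d and f :: "int \<Rightarrow> 'a"
  proof -
    obtain g where g: "\<And>n. g n + B (g (n + int m) - g (n - int m)) = f n" "\<And>n. norm (g n) \<le> 2 * d"
      using ex_small_perturbation_solution[OF B B_small, of f d "int m"] f[rule_format] by blast
    \<comment> \<open>By telescoping, \<open>c (n + 1) - T (c n)\<close> becomes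
      \<open>h n - (T ^^ m) (h (n - int m))\<close>; \<open>h\<close> is chosen so that this is the
      left side of the equation for \<open>g\<close>.\<close>
    define h where "h n = Q (g n) + B (g (n + int m))" for n
    define c where "c n = (\<Sum>j<m. (T ^^ j) (h (n - 1 - int j)))" for n
    have hb: "norm (h n) \<le> (2 * q + 1/2) * d" for n
    proof -
      have "norm (h n) \<le> norm (g n) * q + 1/4 * norm (g (n + int m))"
        unfolding h_def using norm_triangle_le[OF add_mono[OF q(2) B_small]] .
      also have "\<dots> \<le> (2 * d) * q + 1/4 * (2 * d)"
        using q(1) by (intro add_mono mult_right_mono mult_left_mono g) auto
      finally show ?thesis by (simp add: algebra_simps)
    qed
    have "norm (c n) \<le> C * d" for n
    proof -
      have "norm (c n) \<le> (\<Sum>j<m. ((2 * q + 1/2) * d) * p j)"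
        unfolding c_def
        by (intro sum_norm_le order_trans[OF p(2)] mult_right_mono hb less_imp_le[OF p(1)])
      also have "\<dots> = C * d" unfolding C_def sum_distrib_right by (simp add: mult_ac)
      finally show ?thesis .
    qed
    moreover have "c (n + 1) - T (c n) = f n" for n
    proof -
      have "c (n + 1) - T (c n)
          = - (\<Sum>j<m. (T ^^ Suc j) (h (n - int (Suc j))) - (T ^^ j) (h (n - int j)))"
        by (simp add: c_def T.sum sum_subtractf algebra_simps)
      also have "\<dots> = h n - (T ^^ m) (h (n - int m))"
        by (subst sum_lessThan_telescope) simp
      also have "(T ^^ m) (h (n - int m)) = B (g (n - int m)) + (T ^^ (2*m)) (Q (g n))"
        by (simp add: h_def B_def linear_add[OF bounded_linear.linear[OF P]] mult_2 funpow_add)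
      also have "(T ^^ (2*m)) (Q (g n)) = Q (g n) - g n"
        using arg_cong[OF Q(2)[of "g n"], of "\<lambda>y. Q (g n) - y"] by simp
      also have "h n - (B (g (n - int m)) + (Q (g n) - g n)) = f n"
        by (simp add: h_def B.diff flip: g(1)[of n])
      finally show ?thesis .
    qed
    ultimately show ?thesis by (intro exI[of _ c] allI conjI)
  qed
  show ?thesis by (intro exI[of _ C] conjI allI impI C) (rule main)
qed

lemma hyperbolic_shadowing:
  assumes hyp: "hyperbolic T"
  shows "shadowing_property T"
  unfolding shadowing_property_def
proof (intro allI impI)
  fix e :: real assume e: "e > 0"
  obtain C where C: "C > 0" "\<And>d f. (\<forall>n. norm (f n) \<le> d) \<Longrightarrow>
    \<exists>c. \<forall>n::int. c (n + 1) - T (c n) = f n \<and> norm (c n) \<le> C * d"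
    using hyperbolic_inhomogeneous_solution[OF hyp] by blast
  have "\<exists>y. \<forall>n. norm (orb n y - x n) < e"
    if x: "\<forall>n. norm (T (x n) - x (n + 1)) < e / (2 * C)" for x
  proof -
    \<comment> \<open>The defect of \<open>x\<close> serves as right-hand side, so
      \<open>x + c\<close> is an exact orbit; the 2 in the threshold makes the final bound
      strict.\<close>
    obtain c where c: "\<And>n. c (n + 1) - T (c n) = T (x n) - x (n + 1)"
        "\<And>n. norm (c n) \<le> C * (e / (2 * C))"
      using C(2)[of "\<lambda>n. T (x n) - x (n + 1)" "e / (2 * C)"] less_imp_le[OF x[rule_format]] by blast
    have "x (n + 1) + c (n + 1) = T (x n + c n)" for n
      using c(1)[of n] by (simp add: T.add algebra_simps)
    then have orbit: "x n + c n = orb n (x 0 + c 0)" for n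
      by (rule orb_unique)
    have "norm (orb n (x 0 + c 0) - x n) < e" for n
    proof -
      have "norm (orb n (x 0 + c 0) - x n) = norm (c n)"
        unfolding orbit[of n, symmetric] by simp
      also have "\<dots> \<le> C * (e / (2 * C))" by (rule c)
      also have "\<dots> < e" using C(1) e by simp
      finally show ?thesis .
    qed
    then show ?thesis by blast
  qed
  moreover have "e / (2 * C) > 0" using C(1) e by simp
  ultimately show "\<exists>d>0. \<forall>x. (\<forall>n. norm (T (x n) - x (n + 1)) < d) \<longrightarrow>
      (\<exists>y. \<forall>n. norm (orb n y - x n) < e)" by blast
qed

section \<open>Shadowing and closed homoclinic sets imply hyperbolicity\<close>

text \<open>Homogeneity turns the single tolerance 1 and its \<open>d\<close> into a linear estimate
  at every scale.\<close>

lemma shadowing_linear: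
  assumes "shadowing_property T"
  shows "\<exists>K>0. \<forall>\<eta>>0. \<forall>x. (\<forall>n. norm (T (x n) - x (n + 1)) \<le> \<eta>) \<longrightarrow>
    (\<exists>y. \<forall>n. norm (orb n y - x n) \<le> K * \<eta>)"
proof -
  obtain d where d: "d > 0" "\<And>x. (\<forall>n. norm (T (x n) - x (n + 1)) < d) \<Longrightarrow>
      \<exists>y. \<forall>n. norm (orb n y - x n) < 1"
    using assms[unfolded shadowing_property_def, THEN spec, THEN mp, OF zero_less_one] by blast
  have "\<exists>y. \<forall>n. norm (orb n y - x n) \<le> (2 / d) * \<eta>"
    if \<eta>: "\<eta> > 0" and x: "\<And>n. norm (T (x n) - x (n + 1)) \<le> \<eta>" for \<eta> x
  proof -
    \<comment> \<open>Scaling by \<open>t\<close> makes the defect at most \<open>d / 2\<close>;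
      undoing it turns the error 1 into \<open>2 * \<eta> / d\<close>.\<close>
    define t where "t = d / (2 * \<eta>)"
    have t: "t > 0" using d \<eta> by (simp add: t_def)
    have "norm (T (t *\<^sub>R x n) - t *\<^sub>R x (n + 1)) < d" for n
    proof -
      have "norm (T (t *\<^sub>R x n) - t *\<^sub>R x (n + 1)) = t * norm (T (x n) - x (n + 1))"
        using t by (simp add: T.scaleR flip: scaleR_diff_right)
      also have "\<dots> \<le> t * \<eta>" using x t by (intro mult_left_mono) auto
      also have "\<dots> < d" using d \<eta> by (simp add: t_def)
      finally show ?thesis .
    qed
    then obtain y where y: "\<And>n. norm (orb n y - t *\<^sub>R x n) < 1"
      using d(2)[of "\<lambda>n. t *\<^sub>R x n"] by blast
    have "norm (orb n (y /\<^sub>R t) - x n) \<le> (2 / d) * \<eta>" for n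
    proof -
      have "orb n (y /\<^sub>R t) - x n = (orb n y - t *\<^sub>R x n) /\<^sub>R t"
        using t by (simp add: orb.scaleR scaleR_diff_right)
      then have "norm (orb n (y /\<^sub>R t) - x n) = norm (orb n y - t *\<^sub>R x n) / t"
        using t by (simp add: divide_inverse mult.commute)
      also have "\<dots> \<le> 1 / t" using y[of n] t by (intro divide_right_mono) auto
      finally show ?thesis by (simp add: t_def mult.commute)
    qed
    then show ?thesis by blast
  qed
  moreover have "2 / d > 0" using d(1) by simp
  ultimately show ?thesis by blast
qed

text \<open>Damping a bounded orbit by a slowly varying tent function gives a pseudo-orbit with small
  error, whose shadowing orbit is homoclinic.\<close>

lemma shadowing_bounded_orbit_homoclinic:
  assumes sh: "shadowing_property T" and cl: "closed (homoclinic_points r T)" and r: "r > 0"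
    and b: "\<And>n. norm (orb n x) \<le> b"
  shows "x \<in> homoclinic_points r T"
proof -
  obtain K where K: "K > 0" "\<And>\<eta> x. \<eta> > 0 \<Longrightarrow> (\<forall>n. norm (T (x n) - x (n + 1)) \<le> \<eta>) \<Longrightarrow>
    \<exists>y. \<forall>n. norm (orb n y - x n) \<le> K * \<eta>"
    using shadowing_linear[OF sh] by blast
  \<comment> \<open>The added 1 ensures positivity, since the linear estimate requires
    \<open>\<eta> > 0\<close>.\<close>
  define c where "c = b + 1"
  have "b \<ge> 0" using b[of 0] norm_ge_zero order_trans by blast
  then have c: "c > 0" and bc: "\<And>n. norm (orb n x) \<le> c"
    using b order_trans[OF b] by (auto simp: c_def)
  have "\<exists>y\<in>homoclinic_points r T. dist y x < e" if e: "e > 0" for e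
  proof -
    obtain L :: nat where L: "real L > K * c / min r (e/2)" using reals_Archimedean2 by blast
    moreover have "K * c / min r (e/2) > 0" using K(1) c r e by simp
    ultimately have L0: "real L > 0" by linarith
    \<comment> \<open>The bound \<open>r\<close> will make the shadowing point homoclinic, the bound
      \<open>e/2\<close> will keep it near \<open>x\<close>.\<close>
    have small: "K * (c / L) \<le> min r (e/2)"
    proof -
      have "min r (e/2) > 0" using r e by simp
      then have "K * c < real L * min r (e/2)" using L by (simp only: pos_divide_less_eq)
      then have "K * c / real L < min r (e/2)" using L0 by (simp only: pos_divide_less_eq mult.commute)
      then show ?thesis by simp
    qed
    define \<phi> where "\<phi> n = max 0 (1 - \<bar>real_of_int n\<bar> / L)" for n
    have \<phi>: "\<bar>\<phi> n - \<phi> (n + 1)\<bar> \<le> 1 / L" for n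
    proof -
      have "\<bar>\<phi> n - \<phi> (n + 1)\<bar> \<le> \<bar>\<bar>real_of_int n\<bar> / L - \<bar>real_of_int (n + 1)\<bar> / L\<bar>"
        by (auto simp: \<phi>_def max_def)
      also have "\<dots> = \<bar>\<bar>real_of_int n\<bar> - \<bar>real_of_int (n + 1)\<bar>\<bar> / L"
        by (simp flip: diff_divide_distrib)
      also have "\<dots> \<le> 1 / L" by (intro divide_right_mono) auto
      finally show ?thesis .
    qed
    have "norm (T (\<phi> n *\<^sub>R orb n x) - \<phi> (n + 1) *\<^sub>R orb (n + 1) x) \<le> c / L" for n
    proof -
      have "norm (T (\<phi> n *\<^sub>R orb n x) - \<phi> (n + 1) *\<^sub>R orb (n + 1) x)
          = \<bar>\<phi> n - \<phi> (n + 1)\<bar> * norm (orb (n + 1) x)"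
        by (simp add: T.scaleR orb_Suc flip: scaleR_diff_left)
      also have "\<dots> \<le> (1 / L) * c" by (intro mult_mono \<phi> bc) auto
      finally show ?thesis by simp
    qed
    moreover have "c / L > 0" using c L0 by simp
    ultimately obtain y where y: "\<And>n. norm (orb n y - \<phi> n *\<^sub>R orb n x) \<le> K * (c / L)"
      using K(2)[of "c / L" "\<lambda>n. \<phi> n *\<^sub>R orb n x"] by blast
    have "norm (orb n y) \<le> r" if "\<bar>n\<bar> \<ge> int L" for n
    proof -
      have "\<bar>real_of_int n\<bar> \<ge> real L" using that by linarith
      then have "\<phi> n = 0" using L0 by (simp add: \<phi>_def field_simps)
      then show ?thesis using y[of n] small by simp
    qed
    then have "y \<in> homoclinic_points r T" by (auto simp: homoclinic_points_def)
    moreover have "dist y x < e"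
    proof -
      have "norm (y - x) \<le> K * (c / L)" using y[of 0] by (simp add: \<phi>_def)
      moreover have "K * (c / L) \<le> e / 2" using small by (simp only: min.bounded_iff)
      ultimately show ?thesis using e unfolding dist_norm by linarith
    qed
    ultimately show ?thesis by blast
  qed
  then have "x \<in> closure (homoclinic_points r T)" by (simp add: closure_approachable)
  then show ?thesis using cl by simp
qed

lemma homoclinic_points_orb:
  assumes "x \<in> homoclinic_points r T"
  shows "orb k x \<in> homoclinic_points r T"
proof -
  obtain N where N: "\<And>n. \<bar>n\<bar> \<ge> int N \<Longrightarrow> norm (orb n x) \<le> r"
    using assms by (auto simp: homoclinic_points_def)
  have "norm (orb n (orb k x)) \<le> r" if "\<bar>n\<bar> \<ge> int (N + nat \<bar>k\<bar>)" for n
    using that N[of "n + k"] by (simp add: orb_add)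
  then show ?thesis unfolding homoclinic_points_def by blast
qed

lemma homoclinic_points_add:
  assumes "x \<in> homoclinic_points r T" "y \<in> homoclinic_points s T"
  shows "x + y \<in> homoclinic_points (r + s) T"
proof -
  obtain M N where MN: "\<And>n. \<bar>n\<bar> \<ge> int M \<Longrightarrow> norm (orb n x) \<le> r" "\<And>n. \<bar>n\<bar> \<ge> int N \<Longrightarrow> norm (orb n y) \<le> s"
    using assms by (auto simp: homoclinic_points_def)
  have "norm (orb n (x + y)) \<le> r + s" if "\<bar>n\<bar> \<ge> int (max M N)" for n
    unfolding orb.add using that by (intro norm_triangle_le add_mono MN) auto
  then show ?thesis unfolding homoclinic_points_def by blast
qed

text \<open>As \<open>x\<close> is homoclinic for every radius, halving the radius at each addition
  keeps the bound independent of \<open>n\<close>.\<close>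

lemma homoclinic_points_sum:
  assumes "\<And>r. r > 0 \<Longrightarrow> x \<in> homoclinic_points r T" and "r > 0"
  shows "(\<Sum>j<(n::nat). orb (k j) x) \<in> homoclinic_points r T"
  using assms(2)
proof (induction n arbitrary: r)
  case 0
  then show ?case by (auto simp: homoclinic_points_def orb.zero)
next
  case (Suc n)
  then show ?case
    using homoclinic_points_add[OF Suc.IH[of "r/2"] homoclinic_points_orb[OF assms(1)[of "r/2"]]] by simp
qed

text \<open>If \<open>x \<noteq> 0\<close>, then the partial sums of \<open>\<Sum>\<^sub>j T\<^sup>s\<^sup>(\<^sup>j\<^sup>) x\<close> with a sparse sequence \<open>s\<close> are homoclinic, but
  the limit is not, as \<open>T\<^sup>-\<^sup>s\<^sup>(\<^sup>k\<^sup>)\<close> maps it close to \<open>x\<close> for every \<open>k\<close>.\<close>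

lemma closed_homoclinic_imp_zero:
  assumes cl: "\<And>r. r > 0 \<Longrightarrow> closed (homoclinic_points r T)"
    and x: "\<And>r. r > 0 \<Longrightarrow> x \<in> homoclinic_points r T"
  shows "x = 0"
proof (rule ccontr)
  assume "x \<noteq> 0"
  \<comment> \<open>With 1/8, all terms but one will sum to at most \<open>norm x / 4\<close>; added
    to \<open>r = norm x / 2\<close>, this stays below \<open>norm x\<close>.\<close>
  define e where "e = norm x / 8"
  have e: "e > 0" using \<open>x \<noteq> 0\<close> by (simp add: e_def)
  have "\<exists>N. \<forall>n. \<bar>n\<bar> \<ge> int N \<longrightarrow> norm (orb n x) \<le> e * (1/2) ^ j" for j :: nat
    using x[of "e * (1/2) ^ j"] e by (auto simp: homoclinic_points_def)
  then obtain N where N: "\<And>j n. \<bar>n\<bar> \<ge> int (N j) \<Longrightarrow> norm (orb n x) \<le> e * (1/2) ^ j"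
    by metis
  \<comment> \<open>The gap from any earlier index to \<open>j\<close> is at least
    \<open>N j\<close>; the \<open>Suc\<close> gives \<open>s M \<ge> M\<close>, so time
    \<open>- s M\<close> lies where the bound on \<open>v\<close> holds.\<close>
  define s where "s j = (\<Sum>i\<le>j. Suc (N i))" for j :: nat
  have s_diff: "s i + N j \<le> s j" if "i < j" for i j
  proof -
    have "s j = s (j - 1) + Suc (N j)" using that by (cases j) (simp_all add: s_def)
    moreover have "s i \<le> s (j - 1)" unfolding s_def using that by (intro sum_mono2) auto
    ultimately show ?thesis by simp
  qed
  have s_N: "N j \<le> s j" for j by (cases j) (simp_all add: s_def)
  have s_ge: "k \<le> s k" for k by (induction k) (simp_all add: s_def)
  have close: "norm (orb (int (s j) - int (s k)) x) \<le> e * (1/2) ^ j" if "j \<noteq> k" for j k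
  proof (cases "j < k")
    case True
    then have "norm (orb (int (s j) - int (s k)) x) \<le> e * (1/2) ^ k"
      using s_diff[OF True] by (intro N) linarith
    also have "\<dots> \<le> e * (1/2) ^ j"
      using True e by (intro mult_left_mono power_decreasing) auto
    finally show ?thesis .
  next
    case False
    then show ?thesis using that s_diff[of k j] by (intro N) linarith
  qed
  have geo: "(\<lambda>j. e * (1/2) ^ j) sums (e * 2)"
    using geometric_sums[of "1/2::real"] by (intro sums_mult) simp
  have summ: "summable (\<lambda>j. orb (int (s j)) x)"
    using s_N by (intro summable_comparison_test'[OF sums_summable[OF geo]] N) simp
  define v where "v = (\<Sum>j. orb (int (s j)) x)"
  define r where "r = norm x / 2"
  have r: "r > 0" using \<open>x \<noteq> 0\<close> by (simp add: r_def)
  have "v \<in> homoclinic_points r T"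
    unfolding v_def
  proof (rule closed_sequentially[OF cl[OF r] _ summable_LIMSEQ[OF summ]])
    show "(\<Sum>j<n. orb (int (s j)) x) \<in> homoclinic_points r T" for n
      by (rule homoclinic_points_sum[OF x r])
  qed
  then obtain M where M: "\<And>n. \<bar>n\<bar> \<ge> int M \<Longrightarrow> norm (orb n v) \<le> r"
    by (auto simp: homoclinic_points_def)
  \<comment> \<open>Pulling \<open>v\<close> back by \<open>s M\<close> steps turns its
    \<open>M\<close>-th summand into \<open>x\<close> and keeps the others small.\<close>
  define b where "b j = orb (int (s j) - int (s M)) x" for j
  have b: "b sums orb (- int (s M)) v"
    using orb.sums[OF summable_sums[OF summ], of "- int (s M)"]
    by (simp add: b_def[abs_def] v_def flip: orb_add)
  have diff: "(\<lambda>j. b j - (if j = M then x else 0)) sums (orb (- int (s M)) v - x)"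
    by (intro sums_diff b sums_single)
  have "norm (b j - (if j = M then x else 0)) \<le> e * (1/2) ^ j" for j
    using close[of j M] e by (auto simp: b_def)
  from norm_suminf_le[OF this sums_summable[OF geo]]
  have "norm (orb (- int (s M)) v - x) \<le> e * 2"
    unfolding sums_unique[OF diff, symmetric] sums_unique[OF geo, symmetric] .
  moreover have "norm (orb (- int (s M)) v) \<le> r"
    using s_ge[of M] by (intro M) simp
  moreover have "norm x \<le> norm (orb (- int (s M)) v) + norm (orb (- int (s M)) v - x)"
    by norm
  ultimately show False using e unfolding e_def r_def by linarith
qed

text \<open>Shadowing and \<open>zero\<close> make \<open>T - z\<close> surjective with a norm
  estimate; \<open>zero\<close> alone makes it injective.\<close>

lemma expansive_shadowing_imp_hyperbolic:
  assumes sh: "shadowing_property T"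
    and zero: "\<And>x b. (\<And>n. norm (orb n x) \<le> b) \<Longrightarrow> x = 0"
  shows "hyperbolic T"
proof -
  obtain K where K: "K > 0" "\<And>\<eta> x. \<eta> > 0 \<Longrightarrow> (\<forall>n. norm (T (x n) - x (n + 1)) \<le> \<eta>) \<Longrightarrow>
    \<exists>y. \<forall>n. norm (orb n y - x n) \<le> K * \<eta>"
    using shadowing_linear[OF sh] by blast
  have Tc: "T (a *\<^sub>C x) = a *\<^sub>C T x" for a x
    using T by (simp add: bounded_clinear_def)
  have "invertible_operator (\<lambda>x. T x - z *\<^sub>C x)" if z: "cmod z = 1" for z
  proof -
    let ?D = "\<lambda>x. T x - z *\<^sub>C x"
    have z0: "z \<noteq> 0" using z by auto
    have D: "bounded_clinear ?D"
      unfolding bounded_clinear_def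
      by (auto intro!: bounded_linear_sub T.bounded_linear_axioms bounded_linear_scaleC
          simp: Tc scaleC_diff_right scaleC_scaleC mult.commute)
    interpret D: bounded_linear ?D using D by (rule bounded_clinear_imp_bounded_linear)
    have zpow: "z powi (n + 1) = z * z powi n" for n
      using z0 by (simp add: power_int_add)
    have znorm: "cmod (z powi n) = 1" for n
      using z by (simp add: norm_power_int)
    \<comment> \<open>The slack \<open>t\<close> keeps the pseudo-orbit error bound positive even
      for \<open>y = 0\<close>.\<close>
    have surj: "\<exists>u. ?D u = y \<and> norm u \<le> K * (norm y + t)" if t: "t > 0" for y t
    proof -
      obtain x where x: "\<And>n. x (n + 1) = T (x n) + (- (z powi n *\<^sub>C y))"
        using ex_inhomogeneous_orbit[of "\<lambda>n. - (z powi n *\<^sub>C y)"] by blast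
      have "norm (T (x n) - x (n + 1)) \<le> norm y + t" for n
        using t by (simp add: x norm_scaleC znorm)
      moreover have "norm y + t > 0" using t by (simp add: add_nonneg_pos)
      ultimately obtain w where w: "\<And>n. norm (orb n w - x n) \<le> K * (norm y + t)"
        using K(2) by blast
      \<comment> \<open>Although \<open>x\<close> may be unbounded, its difference from the
        shadowing orbit is bounded and solves the same equation.\<close>
      define c where "c n = x n - orb n w" for n
      have cb: "norm (c n) \<le> K * (norm y + t)" for n
        using w[of n] by (simp add: c_def norm_minus_commute)
      have c: "c (n + 1) = T (c n) - z powi n *\<^sub>C y" for n
        by (simp add: c_def x orb_Suc T.diff)
      \<comment> \<open>The forcing term is multiplied by \<open>z\<close> at each step, so it
        cancels here and leaves a bounded orbit.\<close>
      define d where "d n = c (n + 1) - z *\<^sub>C c n" for n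
      have "d (n + 1) = T (d n)" for n
        using c[of n] c[of "n + 1"]
        by (simp add: d_def T.diff Tc scaleC_diff_right scaleC_scaleC zpow)
      then have d: "d n = orb n (d 0)" for n by (rule orb_unique)
      have "norm (orb n (d 0)) \<le> K * (norm y + t) + K * (norm y + t)" for n
        unfolding d[symmetric] unfolding d_def
        using cb[of "n + 1"] cb[of n] norm_triangle_ineq4[of "c (n + 1)" "z *\<^sub>C c n"]
        by (simp add: norm_scaleC z)
      then have "d 0 = 0" by (rule zero)
      then have "?D (c 0) = y" using c[of 0] by (simp add: d_def)
      then show ?thesis using cb by blast
    qed
    have inj: "u = 0" if "?D u = 0" for u
    proof -
      \<comment> \<open>An eigenvector for a unimodular eigenvalue has an orbit of constant
        norm.\<close>
      have "z powi (n + 1) *\<^sub>C u = T (z powi n *\<^sub>C u)" for n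
        using that by (simp add: Tc zpow scaleC_scaleC mult.commute)
      then have "z powi n *\<^sub>C u = orb n u" for n
        using orb_unique[of "\<lambda>n. z powi n *\<^sub>C u" n] by simp
      then have "norm (orb n u) \<le> norm u" for n
        by (metis norm_scaleC znorm mult_1 order_refl)
      then show ?thesis by (rule zero)
    qed
    have inj': "u = v" if "?D u = ?D v" for u v
      using inj[of "u - v"] that D.diff[of u v] by simp
    obtain R where R: "\<And>y. ?D (R y) = y" using surj[OF zero_less_one] by metis
    have RD: "R (?D x) = x" for x by (rule inj') (rule R)
    \<comment> \<open>The slack in \<open>surj\<close> tends to 0, while injectivity identifies each
      solution with \<open>R y\<close>.\<close>
    have Rb: "norm (R y) \<le> norm y * K" for y
    proof (rule field_le_epsilon)
      fix \<epsilon> :: real assume "\<epsilon> > 0"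
      then have "\<epsilon> / K > 0" using K(1) by simp
      then obtain u where "?D u = y" "norm u \<le> K * (norm y + \<epsilon> / K)" using surj by blast
      moreover have "u = R y" using RD[of u] calculation(1) by simp
      moreover have "K * (norm y + \<epsilon> / K) = norm y * K + \<epsilon>" using K(1) by (simp add: field_simps)
      ultimately show "norm (R y) \<le> norm y * K + \<epsilon>" by simp
    qed
    have "bounded_linear R"
    proof (rule bounded_linear_intro[OF _ _ Rb])
      show "R (x + y) = R x + R y" for x y
        by (rule inj') (simp only: D.add R)
      show "R (a *\<^sub>R x) = a *\<^sub>R R x" for a x
        by (rule inj') (simp only: D.scaleR R)
    qed
    moreover have "R (a *\<^sub>C x) = a *\<^sub>C R x" for a x
    proof (rule inj')
      have "?D (a *\<^sub>C R x) = a *\<^sub>C ?D (R x)" using D unfolding bounded_clinear_def by blast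
      then show "?D (R (a *\<^sub>C x)) = ?D (a *\<^sub>C R x)" by (simp only: R)
    qed
    ultimately have "bounded_clinear R" by (simp add: bounded_clinear_def)
    moreover have "R \<circ> ?D = id" "?D \<circ> R = id"
      by (rule ext, simp only: o_apply RD R id_apply)+
    ultimately show ?thesis
      unfolding invertible_operator_def using D by blast
  qed
  then show ?thesis by (auto simp: hyperbolic_def spectrum_def)
qed

end

theorem theorem2p3:
  fixes T :: "'a::complex_banach \<Rightarrow> 'a"
  assumes "invertible_operator T"
  shows "hyperbolic T \<longleftrightarrow>
    shadowing_property T \<and> (\<forall>r>0. closed (homoclinic_points r T))"
proof -
  obtain S where S: "bounded_clinear T" "bounded_clinear S" "S \<circ> T = id" "T \<circ> S = id"
    using assms by (auto simp: invertible_operator_def)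
  interpret invertible_pair T S
    using S by unfold_locales (simp_all add: fun_eq_iff)
  show ?thesis
  proof
    assume "hyperbolic T"
    then show "shadowing_property T \<and> (\<forall>r>0. closed (homoclinic_points r T))"
      by (simp add: hyperbolic_shadowing hyperbolic_homoclinic_points)
  next
    assume R: "shadowing_property T \<and> (\<forall>r>0. closed (homoclinic_points r T))"
    show "hyperbolic T"
    proof (rule expansive_shadowing_imp_hyperbolic)
      show "x = 0" if b: "\<And>n. norm (orb n x) \<le> b" for x b
      proof (rule closed_homoclinic_imp_zero)
        show cl: "closed (homoclinic_points r T)" if "r > 0" for r
          using R that by simp
        show "x \<in> homoclinic_points r T" if "r > 0" for r
          using R by (intro shadowing_bounded_orbit_homoclinic[OF _ cl[OF that] that b]) simp
      qed
    qed (use R in simp)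
  qed
qed

end
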